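(* Let $q=2^r$. For a double coset $D=DC_i^{\epsilon}(n,q)$ with elements ordered $g_1,\dots,g_N$, and $a\in\mathbb{F}_q$, let $c_i^\epsilon(a)=(tr(a\,\mathrm{Tr}\,g_1),\dots,tr(a\,\mathrm{Tr}\,g_N))\in\mathbb{F}_2^N$. Then the map $\mathbb{F}_q\to C(D)^\perp$, $a\mapsto c_i^\epsilon(a)$, is an $\mathbb{F}_2$-linear isomorphism in each of the following cases: (a) $i\in\{1,2\}$, $\epsilon=+$, $n\ge2$ even, all $q$; (b) $i=3$, $\epsilon=+$, and either $n\ge4$ even and all $q$, or $n=2$ and $q\ge8$; (c) $i=4$, $\epsilon=+$, $n\ge4$ even, all $q$; (d) $i=1$, $\epsilon=-$, $n\ge1$ odd, all $q$; (e) $i\in\{2,3\}$, $\epsilon=-$, $n\ge3$ odd, all $q$; (f) $i=4$, $\epsilon=-$, and either $n\ge5$ odd and all $q$, or $n=3$ and $q\ge4$.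
   Context: $q=2^r$, $tr(x)=x+x^2+\cdots+x^{2^{r-1}}$ the trace $\mathbb{F}_q\to\mathbb{F}_2$. $\mathrm{Tr}$ matrix trace, ${}^tX$ transpose, alternating = symmetric with zero diagonal. Fix $\kappa\in\mathbb{F}_q$ with $z^2+z+\kappa$ irreducible. For $n\ge1$, $O^-(2n,q)$ is the group of $g\in GL(2n,q)$ preserving $\theta^-(x)=\sum_{i=1}^{n-1}x_ix_{n-1+i}+x_{2n-1}^2+x_{2n-1}x_{2n}+\kappa x_{2n}^2$. $\delta=\begin{pmatrix}1&1\\0&\kappa\end{pmatrix}$, $\eta=\begin{pmatrix}0&1\\1&0\end{pmatrix}$, $SO^-(2,q)=\{\begin{pmatrix}d_1&\kappa d_2\\ d_2&d_1+d_2\end{pmatrix}:d_1^2+d_1d_2+\kappa d_2^2=1\}$. $Q=Q^-(2n,q)$ is the group of all products (blocks $n-1,n-1,2$) $\begin{pmatrix}A&0&0\\0&{}^tA^{-1}&0\\0&0&i\end{pmatrix}\begin{pmatrix}1_{n-1}&B&{}^th\,{}^ti\,\eta\,i\\0&1_{n-1}&0\\0&h&1_2\end{pmatrix}$ with $A\in GL(n-1,q)$, $i\in SO^-(2,q)$, ${}^tB+{}^th\delta h$ alternating. $\rho=\mathrm{diag}(1_{2n-2},\begin{pmatrix}1&1\\0&1\end{pmatrix})$. $\sigma_s$ ($0\le s\le n-1$) is the permutation matrix interchanging $e^j$ and $e^{n-1+j}$ for $1\le j\le s$. $DC_1^+(n,q)=Q\sigma_{n-1}Q$, $DC_2^+(n,q)=Q\sigma_{n-2}Q$,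 $DC_3^+(n,q)=\rho Q\sigma_{n-2}Q$ ($n$ even); $DC_4^+(n,q)=\rho Q\sigma_{n-3}Q$ ($n\ge4$ even); $DC_1^-(n,q)=Q\sigma_{n-1}Q$ ($n$ odd); $DC_2^-(n,q)=Q\sigma_{n-2}Q$, $DC_3^-(n,q)=\rho Q\sigma_{n-2}Q$, $DC_4^-(n,q)=\rho Q\sigma_{n-3}Q$ ($n\ge3$ odd). Code: $C(D)=\{u\in\mathbb{F}_2^N:\sum_{k=1}^Nu_k\mathrm{Tr}(g_k)=0\text{ in }\mathbb{F}_q\}$, and $C(D)^\perp$ is its dual with respect to the standard dot product on $\mathbb{F}_2^N$. *)

theory Defs
  imports
    "Jordan_Normal_Form.Matrix"
    "HOL-Library.Cardinality"
    "HOL-Library.Z2"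
    "HOL-Computational_Algebra.Computational_Algebra"
    "HOL-Number_Theory.Residues"
begin

text \<open>The field with \<open>q = 2 ^ r\<close> elements is a type \<open>'a :: {field, finite}\<close> with
  \<open>CARD('a) = 2 ^ r\<close>; the field with two elements is the type \<^typ>\<open>bit\<close>, embedded by
  \<open>of_bit\<close>. Matrices and vectors are those of \<open>Jordan_Normal_Form\<close>, where indices start at
  \<open>0\<close> and blocks may be empty, as happens for \<open>n = 1\<close>.\<close>

definition field_trace :: "nat \<Rightarrow> 'a::field \<Rightarrow> bit" where
  "field_trace r x = (THE b. of_bit b = (\<Sum>i<r. x ^ (2 ^ i)))"

definition mat_trace :: "'a::comm_monoid_add mat \<Rightarrow> 'a" where
  "mat_trace A = (\<Sum>i<dim_row A. A $$ (i, i))"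

definition alternating_mat :: "'a::zero mat \<Rightarrow> bool" where
  "alternating_mat X \<longleftrightarrow>
     square_mat X \<and> transpose_mat X = X \<and> (\<forall>i<dim_row X. X $$ (i, i) = 0)"

definition delta_mat :: "'a::field \<Rightarrow> 'a mat" where
  "delta_mat \<kappa> = mat_of_rows_list 2 [[1, 1], [0, \<kappa>]]"

definition eta_mat :: "'a::field mat" where
  "eta_mat = mat_of_rows_list 2 [[0, 1], [1, 0]]"

definition SO2_minus :: "'a::field \<Rightarrow> 'a mat set" where
  "SO2_minus \<kappa> = {mat_of_rows_list 2 [[d1, \<kappa> * d2], [d2, d1 + d2]] | d1 d2.
     d1\<^sup>2 + d1 * d2 + \<kappa> * d2\<^sup>2 = 1}"

text \<open>In the next definition \<open>A'\<close> is the inverse of \<open>A\<close>.\<close>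

definition Q_levi :: "'a::field mat \<Rightarrow> 'a mat \<Rightarrow> 'a mat \<Rightarrow> 'a mat" where
  "Q_levi A A' i = diag_block_mat [A, transpose_mat A', i]"

text \<open>With \<open>W\<close> the product of the transpose of \<open>h\<close>, the transpose of \<open>i\<close>, \<open>\<eta>\<close> and \<open>i\<close>, this is
  the matrix with block rows \<open>(1, B, W)\<close>, \<open>(0, 1, 0)\<close>, \<open>(0, h, 1)\<close>, the blocks having sizes
  \<open>n - 1\<close>, \<open>n - 1\<close>, \<open>2\<close>.\<close>

definition Q_unip :: "nat \<Rightarrow> 'a::field mat \<Rightarrow> 'a mat \<Rightarrow> 'a mat \<Rightarrow> 'a mat" where
  "Q_unip n i B h =
     four_block_mat
       (four_block_mat (1\<^sub>m (n - 1)) B (0\<^sub>m (n - 1) (n - 1)) (1\<^sub>m (n - 1)))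
       (transpose_mat h * transpose_mat i * eta_mat * i @\<^sub>r 0\<^sub>m (n - 1) 2)
       (transpose_mat (0\<^sub>m (n - 1) 2 @\<^sub>r transpose_mat h))
       (1\<^sub>m 2)"

definition Q_minus :: "'a::field \<Rightarrow> nat \<Rightarrow> 'a mat set" where
  "Q_minus \<kappa> n = {Q_levi A A' i * Q_unip n i B h | A A' i B h.
     A \<in> carrier_mat (n - 1) (n - 1) \<and> A' \<in> carrier_mat (n - 1) (n - 1) \<and>
     inverts_mat A A' \<and> inverts_mat A' A \<and>
     i \<in> SO2_minus \<kappa> \<and>
     B \<in> carrier_mat (n - 1) (n - 1) \<and> h \<in> carrier_mat 2 (n - 1) \<and>
     alternating_mat (transpose_mat B + transpose_mat h * delta_mat \<kappa> * h)}"

definition rho_mat :: "nat \<Rightarrow> 'a::field mat" where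
  "rho_mat n = diag_block_mat [1\<^sub>m (2 * n - 2), mat_of_rows_list 2 [[1, 1], [0, 1]]]"

definition sigma_perm :: "nat \<Rightarrow> nat \<Rightarrow> nat \<Rightarrow> nat" where
  "sigma_perm n s j =
     (if j < s then n - 1 + j
      else if n - 1 \<le> j \<and> j < n - 1 + s then j - (n - 1)
      else j)"

definition sigma_mat :: "nat \<Rightarrow> nat \<Rightarrow> 'a::field mat" where
  "sigma_mat n s = mat (2 * n) (2 * n) (\<lambda>(i, j). if i = sigma_perm n s j then 1 else 0)"

definition Q_double_coset :: "'a::field \<Rightarrow> nat \<Rightarrow> nat \<Rightarrow> 'a mat set" where
  "Q_double_coset \<kappa> n s = {x * sigma_mat n s * y | x y. x \<in> Q_minus \<kappa> n \<and> y \<in> Q_minus \<kappa> n}"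

text \<open>The sign in \<open>DC\<^sub>i\<^sup>+\<close> and \<open>DC\<^sub>i\<^sup>-\<close> only records the parity of \<open>n\<close> (\<open>+\<close> for even, \<open>-\<close> for odd
  \<open>n\<close>); the defining formulas agree. The index \<open>i\<close> ranges over \<open>1, 2, 3, 4\<close>.\<close>

definition DC :: "'a::field \<Rightarrow> nat \<Rightarrow> nat \<Rightarrow> 'a mat set" where
  "DC \<kappa> i n =
     (if i = 1 then Q_double_coset \<kappa> n (n - 1)
      else if i = 2 then Q_double_coset \<kappa> n (n - 2)
      else if i = 3 then (*) (rho_mat n) ` Q_double_coset \<kappa> n (n - 2)
      else if i = 4 then (*) (rho_mat n) ` Q_double_coset \<kappa> n (n - 3)
      else {})"

text \<open>An ordering \<open>g\<^sub>1, \<dots>, g\<^sub>N\<close> of a double coset is a distinct list of its elements.\<close>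

definition trace_code :: "'a::field mat list \<Rightarrow> bit vec set" where
  "trace_code gs = {u \<in> carrier_vec (length gs).
     (\<Sum>k<length gs. of_bit (u $ k) * mat_trace (gs ! k)) = 0}"

definition dual_code :: "nat \<Rightarrow> bit vec set \<Rightarrow> bit vec set" where
  "dual_code N C = {v \<in> carrier_vec N. \<forall>u\<in>C. u \<bullet> v = 0}"

definition trace_word :: "nat \<Rightarrow> 'a::field mat list \<Rightarrow> 'a \<Rightarrow> bit vec" where
  "trace_word r gs a = vec (length gs) (\<lambda>k. field_trace r (a * mat_trace (gs ! k)))"

definition F2_linear_iso :: "('a::field \<Rightarrow> bit vec) \<Rightarrow> bit vec set \<Rightarrow> bool" where
  "F2_linear_iso f W \<longleftrightarrow>
     bij_betw f UNIV W \<and>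
     (\<forall>x y. f (x + y) = f x + f y) \<and>
     (\<forall>t x. f (of_bit t * x) = t \<cdot>\<^sub>v f x)"

text \<open>The description in \<open>field_trace\<close> does determine an element of the prime field.\<close>

lemma power_CARD_eq_self:
  fixes x :: "'a::{field,finite}"
  shows "x ^ CARD('a) = x"
proof (cases "x = 0")
  case False
  let ?U = "UNIV - {0 :: 'a}"
  have "(\<Prod>y\<in>?U. x * y) = (\<Prod>y\<in>?U. y)"
    by (rule prod.reindex_bij_witness[of _ "\<lambda>y. y / x" "\<lambda>y. x * y"]) (use False in auto)
  then have "x ^ card ?U * (\<Prod>y\<in>?U. y) = (\<Prod>y\<in>?U. y)"
    by (simp add: prod.distrib)
  then have "x ^ card ?U = 1"
    by simp
  moreover have "CARD('a) = Suc (card ?U)"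
    by (rule card.remove) simp_all
  ultimately show ?thesis
    by (simp only: power_Suc mult_1_right)
qed (simp add: power_0_left)

lemma CHAR_eq_2:
  assumes "CARD('a::{field,finite}) = 2 ^ r"
  shows "CHAR('a) = 2"
proof -
  have "prime CHAR('a)"
    by (rule prime_CHAR_semidom) (simp add: finite_imp_CHAR_pos)
  moreover have "CHAR('a) dvd 2 ^ r"
    using CHAR_dvd_CARD[where 'a = 'a] assms by simp
  ultimately show ?thesis
    using prime_dvd_power[of "CHAR('a)" 2 r] primes_dvd_imp_eq[of "CHAR('a)" 2] two_is_prime_nat
    by blast
qed

lemma of_bit_field_trace:
  fixes x :: "'a::{field,finite}"
  assumes "CARD('a) = 2 ^ r"
  shows "of_bit (field_trace r x) = (\<Sum>i<r. x ^ (2 ^ i))"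
proof -
  define S T where "S = (\<Sum>i<r. x ^ (2 ^ i))" and "T = (\<Sum>i<r. x ^ (2 ^ Suc i))"
  have c: "CHAR('a) = 2"
    using assms by (rule CHAR_eq_2)
  have "S ^ CHAR('a) = (\<Sum>i<r. (x ^ (2 ^ i)) ^ CHAR('a))"
    unfolding S_def by (rule freshmans_dream_sum) (simp_all add: c)
  also have "\<dots> = T"
    unfolding T_def c by (rule sum.cong) (simp_all only: power_Suc2 power_mult)
  finally have "S * S = T"
    by (simp only: c power2_eq_square)
  moreover have "x + T = S + x ^ (2 ^ r)"
    using sum.lessThan_Suc_shift[of "\<lambda>i. x ^ (2 ^ i)" r]
      sum.lessThan_Suc[of "\<lambda>i. x ^ (2 ^ i)" r]
    unfolding S_def T_def by (simp only: power_0 power_one_right)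
  moreover have "x ^ (2 ^ r) = x"
    using power_CARD_eq_self[of x] unfolding assms .
  ultimately have "S * S = S"
    by simp
  then have "S = 0 \<or> S = 1"
    by simp
  then obtain b :: bit where b: "of_bit b = S"
    using that[of 0] that[of 1] by fastforce
  show ?thesis
    unfolding field_trace_def S_def[symmetric]
  proof (rule theI)
    show "of_bit b = S" by (rule b)
    show "b' = b" if "of_bit b' = S" for b'
      using that b by (cases b; cases b') (auto simp: of_bool_def split: if_splits)
  qed
qed

end

theory Submission
  imports Defs "Jordan_Normal_Form.Determinant"
begin

text \<open>By Delsarte's theorem the dual code consists of the words \<open>tr (a * Tr g\<^sub>k)\<close>, so everything
  reduces to showing that the matrix traces of a double coset generate the additive group of the
  field.

  Multiplying \<open>\<sigma>\<^sub>s\<close> with \<open>s \<ge> 1\<close> by the unipotent element of \<open>Q\<close> for which \<open>h\<close> has the single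
  entry \<open>t\<close> and \<open>B\<close> the single entry \<open>t\<^sup>2\<close> gives trace \<open>t\<^sup>2\<close>, with or without the factor \<open>\<rho>\<close>; squaring
  is onto, so every element is a trace. The cases with \<open>s = 0\<close> remain, where Levi elements have
  trace \<open>Tr A + Tr A\<^sup>-\<^sup>1 + Tr i\<close>, and \<open>\<rho>\<close> makes \<open>i = 1\<close> contribute \<open>0\<close>. Without \<open>\<rho>\<close> one takes
  \<open>A = 1\<close>: the traces of \<open>SO\<^sup>-(2, q)\<close> alone fill more than half of the field. With \<open>\<rho>\<close> and \<open>n = 3\<close>,
  companion matrices \<open>A\<close> of fixed determinant \<open>d \<noteq> 0, 1\<close> realise every element. With \<open>\<rho>\<close> and
  \<open>n = 2\<close>, the elements \<open>a + 1/a\<close> generate a group that is closed under multiplication and contains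
  about half of the field, whereas a proper subring has at most \<open>\<surd>q\<close> elements.\<close>

unbundle no Formal_Power_Series.fps_syntax

section \<open>Characteristic two\<close>

lemma add_self_CHAR_2:
  fixes x :: "'a::ring_1"
  assumes "CHAR('a) = 2"
  shows "x + x = 0"
  using minus_CHAR_2[OF assms, of x x] by simp

lemma surj_power2_CHAR_2:
  assumes "CHAR('a::{idom,finite}) = 2"
  shows "surj (\<lambda>x::'a. x\<^sup>2)"
proof -
  have "inj (\<lambda>x::'a. x\<^sup>2)"
    by (rule injI) (simp add: power2_eq_iff uminus_CHAR_2[OF assms])
  then show ?thesis by (simp add: finite_UNIV_inj_surj)
qed

lemma of_bit_add_CHAR_2:
  assumes "CHAR('a::ring_1) = 2"
  shows "of_bit (b + c) = (of_bit b + of_bit c :: 'a)"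
  using add_self_CHAR_2[OF assms, of 1] by (cases b; cases c) auto

lemma of_bit_eq_iff: "of_bit b = (of_bit c :: 'a::zero_neq_one) \<longleftrightarrow> b = c"
  by (cases b; cases c) auto

section \<open>Character sums\<close>

definition sign_of_bit :: "bit \<Rightarrow> int" where
  "sign_of_bit b = (if b = 0 then 1 else - 1)"

lemma sign_of_bit_0 [simp]: "sign_of_bit 0 = 1"
  by (simp add: sign_of_bit_def)

lemma sign_of_bit_add: "sign_of_bit (b + c) = sign_of_bit b * sign_of_bit c"
  by (cases b; cases c) (auto simp: sign_of_bit_def)

lemma sum_sign_of_bit_eq_0:
  assumes "\<And>x. x \<in> X \<Longrightarrow> \<tau> x \<in> X" and "\<And>x. x \<in> X \<Longrightarrow> \<tau> (\<tau> x) = x"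
    and "\<And>x. x \<in> X \<Longrightarrow> \<phi> (\<tau> x) = \<phi> x + 1"
  shows "(\<Sum>x\<in>X. sign_of_bit (\<phi> x)) = 0"
proof -
  have "(\<Sum>x\<in>X. sign_of_bit (\<phi> x)) = (\<Sum>x\<in>X. sign_of_bit (\<phi> (\<tau> x)))"
    by (rule sum.reindex_bij_witness[of _ \<tau> \<tau>]) (auto simp: assms(1,2))
  also have "\<dots> = (\<Sum>x\<in>X. - sign_of_bit (\<phi> x))"
    by (intro sum.cong refl) (simp only: assms(3) sign_of_bit_add, simp add: sign_of_bit_def)
  finally show ?thesis by (simp add: sum_negf)
qed

lemma finite_carrier_vec_bit: "finite (carrier_vec n :: bit vec set)"
proof -
  have "carrier_vec n \<subseteq> vec_of_list ` {xs. set xs \<subseteq> {0, 1 :: bit} \<and> length xs = n}"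
  proof
    fix u :: "bit vec" assume "u \<in> carrier_vec n"
    then show "u \<in> vec_of_list ` {xs. set xs \<subseteq> {0, 1} \<and> length xs = n}"
      by (intro image_eqI[of _ _ "list_of_vec u"]) (auto simp: vec_list)
  qed
  then show ?thesis
    by (rule finite_subset) (simp add: finite_lists_length_eq)
qed

lemma add_bit_vec_eq_0_iff:
  fixes v w :: "bit vec"
  assumes "v \<in> carrier_vec n" "w \<in> carrier_vec n"
  shows "v + w = 0\<^sub>v n \<longleftrightarrow> v = w"
proof -
  have bit: "b + c = 0 \<longleftrightarrow> b = c" for b c :: bit by (cases b; cases c) auto
  show ?thesis
    using assms by (auto simp: vec_eq_iff bit simp del: add_bit_eq_xor)
qed

lemma sum_sign_of_bit_scalar_prod:
  assumes w: "w \<in> carrier_vec n" "w \<noteq> 0\<^sub>v n"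
  shows "(\<Sum>u\<in>carrier_vec n. sign_of_bit (u \<bullet> w)) = 0"
proof -
  obtain k where k: "k < n" "w $ k = 1"
  proof -
    have "\<exists>k<n. w $ k \<noteq> 0" using w by (auto intro!: eq_vecI)
    then show ?thesis using that by auto
  qed
  show ?thesis
  proof (rule sum_sign_of_bit_eq_0)
    fix u :: "bit vec" assume u: "u \<in> carrier_vec n"
    show "u + unit_vec n k \<in> carrier_vec n" using u by simp
    show "u + unit_vec n k + unit_vec n k = u"
      using u add_bit_vec_eq_0_iff[of "unit_vec n k" n "unit_vec n k"]
      by (simp add: assoc_add_vec[where n = n])
    show "(u + unit_vec n k) \<bullet> w = u \<bullet> w + 1"
      using u k w(1) by (simp add: add_scalar_prod_distrib[where n = n] del: add_bit_eq_xor)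
  qed
qed

section \<open>Delsarte duality for trace codes\<close>

definition syndrome :: "'a::field mat list \<Rightarrow> bit vec \<Rightarrow> 'a" where
  "syndrome gs u = (\<Sum>k<length gs. of_bit (u $ k) * mat_trace (gs ! k))"

lemma trace_code_eq_syndrome_kernel:
  "trace_code gs = {u \<in> carrier_vec (length gs). syndrome gs u = 0}"
  by (simp add: trace_code_def syndrome_def)

lemma trace_word_carrier: "trace_word r gs a \<in> carrier_vec (length gs)"
  by (simp add: trace_word_def)

context
  fixes r :: nat
  assumes card: "CARD('a::{field,finite}) = 2 ^ r"
begin

lemma additive_field_trace: "additive (field_trace r :: 'a \<Rightarrow> bit)"
proof
  fix x y :: 'a
  have char: "CHAR('a) = 2" using card by (rule CHAR_eq_2)
  have "(x + y) ^ 2 ^ i = x ^ 2 ^ i + y ^ 2 ^ i" for i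
    by (rule freshmans_dream') (simp_all add: char)
  then have "(of_bit (field_trace r (x + y)) :: 'a) = of_bit (field_trace r x + field_trace r y)"
    by (simp only: of_bit_field_trace[OF card] sum.distrib of_bit_add_CHAR_2[OF char])
  then show "field_trace r (x + y) = field_trace r x + field_trace r y"
    by (simp only: of_bit_eq_iff)
qed

lemmas field_trace_add = additive.add[OF additive_field_trace]
  and field_trace_0 = additive.zero[OF additive_field_trace]
  and field_trace_sum = additive.sum[OF additive_field_trace]

lemma field_trace_of_bit_mult: "field_trace r (of_bit b * x :: 'a) = b * field_trace r x"
  by (cases b) (auto simp: field_trace_0)

lemma ex_field_trace_eq_1: "\<exists>x::'a. field_trace r x = 1"
proof (rule ccontr)
  assume "\<nexists>x::'a. field_trace r x = 1"
  then have trace_0: "field_trace r x = 0" for x :: 'a by simp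
  define p :: "'a poly" where "p = (\<Sum>i<r. Polynomial.monom 1 (2 ^ i))"
  have "2 \<le> CARD('a)"
    using card_mono[of UNIV "{0, 1 :: 'a}"] by simp
  then have "r > 0" using card by (cases r) auto
  have "Polynomial.coeff p 1 = (\<Sum>i<r. if i = 0 then 1 else 0)"
    unfolding p_def coeff_sum by (rule sum.cong) auto
  then have "p \<noteq> 0" using \<open>r > 0\<close> by auto
  have "poly p x = 0" for x
    using of_bit_field_trace[OF card, of x] trace_0[of x] by (simp add: p_def poly_sum poly_monom)
  then have "CARD('a) \<le> degree p"
    using card_poly_roots_bound[OF \<open>p \<noteq> 0\<close>] by simp
  also have "\<dots> \<le> 2 ^ (r - 1)"
    unfolding p_def by (rule degree_sum_le) (auto intro: order.trans[OF degree_monom_le])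
  also have "\<dots> < 2 ^ r" using \<open>r > 0\<close> by simp
  finally show False using card by simp
qed

lemma field_trace_nondegenerate:
  fixes a :: 'a
  assumes "a \<noteq> 0"
  shows "\<exists>x. field_trace r (a * x) = 1"
proof -
  obtain y :: 'a where "field_trace r y = 1" using ex_field_trace_eq_1 by blast
  then have "field_trace r (a * (y / a)) = 1" using assms by simp
  then show ?thesis ..
qed

lemma sum_sign_of_bit_field_trace:
  "(\<Sum>a\<in>UNIV. sign_of_bit (field_trace r (a * x))) = (if x = 0 then int CARD('a) else 0)"
  for x :: 'a
proof (cases "x = 0")
  case False
  then obtain z where z: "field_trace r (z * x) = 1"
    using field_trace_nondegenerate[of x] by (auto simp: mult.commute)
  have "z + z = 0" using CHAR_eq_2[OF card] by (rule add_self_CHAR_2)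
  then have "(\<Sum>a\<in>UNIV. sign_of_bit (field_trace r (a * x))) = 0"
    by (intro sum_sign_of_bit_eq_0[where \<tau> = "\<lambda>a. a + z"])
      (simp_all only: UNIV_I distrib_right field_trace_add z add.assoc add_0_right)
  with False show ?thesis by simp
qed (simp add: field_trace_0)

lemma scalar_prod_trace_word:
  "u \<bullet> trace_word r gs a = field_trace r (a * syndrome gs u)" for a :: 'a
proof -
  have "u \<bullet> trace_word r gs a =
      (\<Sum>k<length gs. u $ k * field_trace r (a * mat_trace (gs ! k)))"
    by (simp add: scalar_prod_def trace_word_def lessThan_atLeast0)
  also have "\<dots> = (\<Sum>k<length gs. field_trace r (a * (of_bit (u $ k) * mat_trace (gs ! k))))"
    by (simp only: field_trace_of_bit_mult[symmetric] mult.left_commute)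
  finally show ?thesis by (simp only: syndrome_def field_trace_sum sum_distrib_left)
qed

text \<open>If \<open>v\<close> is no trace word, then the sum of \<open>(-1) ^ (u \<bullet> (v + c(a)))\<close> over \<open>u\<close> vanishes for every
  \<open>a\<close>, where \<open>c(a)\<close> is the trace word of \<open>a\<close>. Summed over \<open>a\<close> first, however, only the \<open>u\<close> in the
  code contribute, each of them \<open>q\<close> when \<open>v\<close> is in the dual code.\<close>

lemma dual_trace_code_subset:
  fixes gs :: "'a mat list"
  shows "dual_code (length gs) (trace_code gs) \<subseteq> range (trace_word r gs)"
proof (intro subsetI, rule ccontr)
  let ?V = "carrier_vec (length gs)" and ?C = "trace_code gs"
  fix v assume v: "v \<in> dual_code (length gs) ?C" and not_word: "v \<notin> range (trace_word r gs)"
  have carrier: "v \<in> ?V" using v by (simp add: dual_code_def)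
  have subset: "?C \<subseteq> ?V" by (auto simp: trace_code_def)
  have fin: "finite ?C" using finite_carrier_vec_bit by (rule finite_subset[OF subset])
  have nonzero: "v + trace_word r gs a \<noteq> 0\<^sub>v (length gs)" for a
    using not_word add_bit_vec_eq_0_iff[OF carrier trace_word_carrier] by blast
  have pairing: "u \<bullet> (v + trace_word r gs a) = u \<bullet> v + field_trace r (a * syndrome gs u)"
    if "u \<in> ?V" for u a
    using scalar_prod_add_distrib[OF that carrier trace_word_carrier] scalar_prod_trace_word
    by simp
  have "0 = (\<Sum>a\<in>UNIV. \<Sum>u\<in>?V. sign_of_bit (u \<bullet> (v + trace_word r gs a)))"
    using sum_sign_of_bit_scalar_prod[OF add_carrier_vec[OF carrier trace_word_carrier] nonzero]
    by simp
  also have "\<dots> = (\<Sum>a\<in>UNIV. \<Sum>u\<in>?V.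
      sign_of_bit (u \<bullet> v) * sign_of_bit (field_trace r (a * syndrome gs u)))"
    by (intro sum.cong refl) (simp only: pairing sign_of_bit_add)
  also have "\<dots> = (\<Sum>u\<in>?V. sign_of_bit (u \<bullet> v) *
      (\<Sum>a\<in>UNIV. sign_of_bit (field_trace r (a * syndrome gs u))))"
    by (subst sum.swap) (simp only: sum_distrib_left)
  also have "\<dots> = (\<Sum>u\<in>?C. sign_of_bit (u \<bullet> v) * int CARD('a))"
    unfolding sum_sign_of_bit_field_trace trace_code_eq_syndrome_kernel
    by (rule sum.mono_neutral_cong_right) (auto simp: finite_carrier_vec_bit)
  also have "\<dots> = int (card ?C * CARD('a))"
    using v by (simp add: dual_code_def)
  finally have "?C = {}" using fin by simp
  moreover have "0\<^sub>v (length gs) \<in> ?C" by (auto simp: trace_code_def intro!: sum.neutral)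
  ultimately show False by blast
qed

lemma dual_trace_code_eq_range:
  "dual_code (length gs) (trace_code gs) = range (trace_word r gs)" for gs :: "'a mat list"
proof
  show "range (trace_word r gs) \<subseteq> dual_code (length gs) (trace_code gs)"
    by (auto simp: dual_code_def trace_word_carrier scalar_prod_trace_word
        trace_code_eq_syndrome_kernel field_trace_0)
qed (rule dual_trace_code_subset)

lemma trace_word_add: "trace_word r gs (a + b) = trace_word r gs a + trace_word r gs b"
  for a b :: 'a
  by (auto simp: trace_word_def distrib_right field_trace_add)

lemma trace_word_of_bit_mult: "trace_word r gs (of_bit t * a) = t \<cdot>\<^sub>v trace_word r gs a"
  for a :: 'a
  by (rule eq_vecI)
    (simp_all only: trace_word_def mult.assoc field_trace_of_bit_mult index_vec dim_vec
      index_smult_vec)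

lemma inj_trace_word:
  fixes gs :: "'a mat list"
  assumes "group_closure (mat_trace ` set gs) = UNIV"
  shows "inj (trace_word r gs)"
proof (rule injI)
  fix a b :: 'a
  assume eq: "trace_word r gs a = trace_word r gs b"
  have "field_trace r ((a - b) * x) = 0" if "x \<in> group_closure (mat_trace ` set gs)" for x
    using that
  proof induction
    case (base x)
    show ?case
    proof (cases "x = 0")
      case False
      with base obtain k where "k < length gs" "x = mat_trace (gs ! k)"
        by (auto simp: in_set_conv_nth)
      then show ?thesis
        using arg_cong[OF eq, of "\<lambda>w. w $ k"]
        by (simp add: trace_word_def left_diff_distrib additive.diff[OF additive_field_trace])
    qed (simp add: field_trace_0)
  next
    case (diff x y)
    then show ?case by (simp add: right_diff_distrib additive.diff[OF additive_field_trace])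
  qed
  then show "a = b" using field_trace_nondegenerate[of "a - b"] assms by auto
qed

lemma F2_linear_iso_trace_word:
  fixes gs :: "'a mat list"
  assumes "group_closure (mat_trace ` set gs) = UNIV"
  shows "F2_linear_iso (trace_word r gs) (dual_code (length gs) (trace_code gs))"
  unfolding F2_linear_iso_def bij_betw_def dual_trace_code_eq_range
  using inj_trace_word[OF assms] trace_word_add trace_word_of_bit_mult by blast

end

section \<open>Generating the additive group of a finite field\<close>

lemma group_closure_superset: "S \<subseteq> group_closure S"
  by (auto intro: group_closure.base)

lemma group_closure_mono:
  assumes "S \<subseteq> T"
  shows "group_closure S \<subseteq> group_closure T"
proof
  fix x assume "x \<in> group_closure S"
  then show "x \<in> group_closure T"
    by induction (use assms in \<open>auto intro: group_closure.intros\<close>)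
qed

lemma group_closure_eq_UNIV_if_card_gt_half:
  fixes T :: "'a::{ab_group_add,finite} set"
  assumes "CARD('a) < 2 * card T"
  shows "group_closure T = UNIV"
proof -
  have "y \<in> group_closure T" for y
  proof -
    have "card ((-) y ` T) = card T"
      by (rule card_image) (auto simp: inj_on_def)
    moreover have "card (T \<union> (-) y ` T) \<le> CARD('a)" by (rule card_mono) auto
    ultimately have "T \<inter> (-) y ` T \<noteq> {}"
      using card_Un_Int[of T "(-) y ` T"] assms by auto
    then obtain t u where "t \<in> T" "u \<in> T" "t = y - u" by blast
    then have "y = t + u" by simp
    with \<open>t \<in> T\<close> \<open>u \<in> T\<close> show ?thesis
      using group_closure_superset by (blast intro: group_closure_add)
  qed
  then show ?thesis by blast
qed

lemma group_closure_mult: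
  fixes S :: "'a::ring set"
  assumes "\<And>x y. x \<in> S \<Longrightarrow> y \<in> S \<Longrightarrow> x * y \<in> group_closure S"
    and "x \<in> group_closure S" "y \<in> group_closure S"
  shows "x * y \<in> group_closure S"
  using assms(2)
proof induction
  case (base x)
  show ?case
    using assms(3)
    by induction (use base assms(1) in \<open>auto simp: right_diff_distrib intro: group_closure.diff\<close>)
next
  case (diff x x')
  then show ?case by (simp add: left_diff_distrib group_closure.diff)
qed

lemma card_power2_le_CARD_if_proper_subring:
  fixes K :: "'a::{field,finite} set"
  assumes diff: "\<And>x y. x \<in> K \<Longrightarrow> y \<in> K \<Longrightarrow> x - y \<in> K"
    and mult: "\<And>x y. x \<in> K \<Longrightarrow> y \<in> K \<Longrightarrow> x * y \<in> K"
    and "x \<notin> K"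
  shows "(card K)\<^sup>2 \<le> CARD('a)"
proof -
  have mult_surj: "(\<lambda>w. w * y) ` K = K" if "y \<in> K" "y \<noteq> 0" for y
    using that mult by (intro endo_inj_surj) (auto simp: inj_on_def)
  have "inj_on (\<lambda>(a, b). a + b * x) (K \<times> K)"
  proof (rule inj_onI; clarsimp)
    fix a b a' b'
    assume K: "a \<in> K" "b \<in> K" "a' \<in> K" "b' \<in> K" and eq: "a + b * x = a' + b' * x"
    have "b = b'"
    proof (rule ccontr)
      assume "b \<noteq> b'"
      then have "a' - a \<in> (\<lambda>w. w * (b - b')) ` K"
        using mult_surj[of "b - b'"] diff K by simp
      then obtain w where "w \<in> K" "a' - a = w * (b - b')" by blast
      moreover have "x * (b - b') = a' - a" using eq by (simp add: algebra_simps)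
      ultimately show False using \<open>b \<noteq> b'\<close> \<open>x \<notin> K\<close> by simp
    qed
    then show "a = a' \<and> b = b'" using eq by simp
  qed
  then have "card (K \<times> K) \<le> CARD('a)"
    by (metis card_image card_mono finite_UNIV finite subset_UNIV)
  then show ?thesis by (simp add: card_cartesian_product power2_eq_square)
qed

lemma card_le_mult_card_image:
  assumes "finite A" and "\<And>y. card {x \<in> A. f x = y} \<le> n"
  shows "card A \<le> n * card (f ` A)"
proof -
  have "card A = (\<Sum>y\<in>f ` A. card {x \<in> A. f x = y})"
    using sum.image_gen[OF assms(1), of "\<lambda>_. 1 :: nat" f] by simp
  also have "\<dots> \<le> (\<Sum>y\<in>f ` A. n)" by (intro sum_mono assms(2))
  finally show ?thesis by (simp add: mult.commute)
qed

lemma card_quadratic_roots_le: "card {x::'a::idom. x\<^sup>2 + b * x + c = 0} \<le> 2"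
  using card_poly_roots_bound[of "[:c, b, 1:]"]
  by (simp add: power2_eq_square algebra_simps)

definition inverse_sums :: "'a::field set" where
  "inverse_sums = {a + inverse a | a. a \<noteq> 0}"

lemma card_inverse_sums: "CARD('a::{field,finite}) \<le> 2 * card (inverse_sums :: 'a set) + 1"
proof -
  have "card {a \<in> UNIV - {0}. a + inverse a = y} \<le> 2" for y :: 'a
  proof -
    have "{a \<in> UNIV - {0}. a + inverse a = y} \<subseteq> {a. a\<^sup>2 + (- y) * a + 1 = 0}"
      by (auto simp: power2_eq_square algebra_simps)
    from order.trans[OF card_mono[OF finite this] card_quadratic_roots_le] show ?thesis .
  qed
  then have "card (UNIV - {0::'a}) \<le> 2 * card ((\<lambda>a. a + inverse a) ` (UNIV - {0::'a}))"
    by (intro card_le_mult_card_image) auto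
  moreover have "(\<lambda>a. a + inverse a) ` (UNIV - {0::'a}) = inverse_sums"
    by (auto simp: inverse_sums_def)
  ultimately show ?thesis by (simp add: card_Diff_singleton)
qed

lemma mult_inverse_sums_in_group_closure:
  assumes "x \<in> inverse_sums" and "y \<in> inverse_sums"
  shows "x * y \<in> group_closure inverse_sums"
proof -
  obtain a b where nonzero: "a \<noteq> 0" "b \<noteq> 0" and xy: "x = a + inverse a" "y = b + inverse b"
    using assms by (auto simp: inverse_sums_def)
  have "x * y = (a * b + inverse (a * b)) + (a / b + inverse (a / b))"
    unfolding xy using nonzero by (simp add: field_simps)
  moreover have "a * b + inverse (a * b) \<in> inverse_sums" "a / b + inverse (a / b) \<in> inverse_sums"
    unfolding inverse_sums_def using nonzero by (fastforce, fastforce)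
  ultimately show ?thesis
    by (simp only: group_closure_add group_closure.base insertI2)
qed

lemma group_closure_inverse_sums_eq_UNIV:
  assumes "CARD('a::{field,finite}) \<ge> 8"
  shows "group_closure inverse_sums = (UNIV :: 'a set)"
proof (rule ccontr)
  let ?K = "group_closure inverse_sums :: 'a set"
  assume "?K \<noteq> UNIV"
  then obtain x where "x \<notin> ?K" by blast
  have "card (inverse_sums :: 'a set) \<le> card ?K"
    by (intro card_mono group_closure_superset) simp
  then have upper: "CARD('a) \<le> 2 * card ?K + 1"
    using card_inverse_sums[where 'a = 'a] by linarith
  then have "4 \<le> card ?K" using assms by simp
  then have "4 * card ?K \<le> (card ?K)\<^sup>2" by (simp add: power2_eq_square)
  also have "\<dots> \<le> CARD('a)"
    using group_closure.diff group_closure_mult[OF mult_inverse_sums_in_group_closure] \<open>x \<notin> ?K\<close>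
    by (rule card_power2_le_CARD_if_proper_subring)
  finally show False using upper \<open>4 \<le> card ?K\<close> by linarith
qed

text \<open>For \<open>d\<^sub>2 \<noteq> 0\<close> the equation says \<open>z\<^sup>2 + z + \<kappa> = 1 / d\<^sub>2\<^sup>2\<close> with \<open>z = d\<^sub>1 / d\<^sub>2\<close>.\<close>

lemma card_norm_one_second_coordinates:
  fixes \<kappa> :: "'a::{field,finite}"
  assumes char: "CHAR('a) = 2" and no_root: "\<And>z. z\<^sup>2 + z + \<kappa> \<noteq> 0"
  shows "CARD('a) < 2 * card {d2. \<exists>d1. d1\<^sup>2 + d1 * d2 + \<kappa> * d2\<^sup>2 = 1}"
proof -
  let ?T = "{d2. \<exists>d1. d1\<^sup>2 + d1 * d2 + \<kappa> * d2\<^sup>2 = 1}" and ?f = "\<lambda>z. z\<^sup>2 + z + \<kappa>"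
  have "?f z \<in> (\<lambda>d. inverse (d\<^sup>2)) ` (?T - {0})" for z
  proof -
    obtain d where d: "inverse (?f z) = d\<^sup>2"
      using surj_power2_CHAR_2[OF char] by (metis surjD)
    then have f: "?f z = inverse (d\<^sup>2)" by (metis inverse_inverse_eq)
    then have "d \<noteq> 0" using no_root[of z] by auto
    have "(z * d)\<^sup>2 + z * d * d + \<kappa> * d\<^sup>2 = ?f z * d\<^sup>2"
      by (simp add: power2_eq_square algebra_simps)
    also have "\<dots> = 1" using f \<open>d \<noteq> 0\<close> by simp
    finally show ?thesis using f \<open>d \<noteq> 0\<close> by blast
  qed
  then have "range ?f \<subseteq> (\<lambda>d. inverse (d\<^sup>2)) ` (?T - {0})" by blast
  then have "card (range ?f) \<le> card (?T - {0})"
    by (rule surj_card_le[rotated]) simp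
  moreover have "0 \<in> ?T" by (auto intro!: exI[of _ 1])
  then have "card (?T - {0}) < card ?T"
    by (intro card_Diff1_less) auto
  moreover have "card {z. ?f z = w} \<le> 2" for w
    using card_quadratic_roots_le[of 1 "\<kappa> - w"] by (simp add: algebra_simps)
  then have "CARD('a) \<le> 2 * card (range ?f)"
    by (intro card_le_mult_card_image) auto
  ultimately show ?thesis by linarith
qed

section \<open>Matrix traces\<close>

lemma sum_lessThan_add:
  fixes f :: "nat \<Rightarrow> 'a::comm_monoid_add"
  shows "(\<Sum>i<a + b. f i) = (\<Sum>i<a. f i) + (\<Sum>i<b. f (a + i))"
  by (induction b) (auto simp: ac_simps)

lemma mat_trace_four_block_mat:
  assumes "A \<in> carrier_mat a a" "D \<in> carrier_mat d d"
  shows "mat_trace (four_block_mat A B C D) = mat_trace A + mat_trace D"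
  using assms by (simp add: mat_trace_def sum_lessThan_add)

lemma mat_trace_diag_block_mat:
  assumes "\<And>A. A \<in> set As \<Longrightarrow> square_mat A"
  shows "mat_trace (diag_block_mat As) = (\<Sum>A\<leftarrow>As. mat_trace A)"
  using assms
proof (induction As)
  case Nil
  then show ?case by (simp add: mat_trace_def)
next
  case (Cons A As)
  let ?D = "diag_block_mat As"
  have "square_mat A" "square_mat ?D"
    using Cons.prems by (simp, intro diag_block_mat_square) simp
  then have "A \<in> carrier_mat (dim_row A) (dim_row A)" "?D \<in> carrier_mat (dim_row ?D) (dim_row ?D)"
    by (intro carrier_matI; simp)+
  then have "mat_trace (diag_block_mat (A # As)) = mat_trace A + mat_trace ?D"
    by (simp only: diag_block_mat.simps Let_def mat_trace_four_block_mat)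
  then show ?case using Cons by (simp only: list.map sum_list.Cons list.set_intros)
qed

lemma mat_trace_transpose_mat: "square_mat A \<Longrightarrow> mat_trace (transpose_mat A) = mat_trace A"
  by (simp add: mat_trace_def)

lemma mat_trace_one_mat: "mat_trace (1\<^sub>m a) = (of_nat a :: 'a::semiring_1)"
  by (simp add: mat_trace_def)

lemma mat_trace_addrow:
  assumes "A \<in> carrier_mat n n" "k < n"
  shows "mat_trace (addrow c k l A) = mat_trace A + c * A $$ (l, k)"
proof -
  have "mat_trace (addrow c k l A) = (\<Sum>i<n. A $$ (i, i) + (if i = k then c * A $$ (l, k) else 0))"
    unfolding mat_trace_def using assms by (intro sum.cong) (auto simp: add.commute)
  then show ?thesis using assms by (simp add: sum.distrib mat_trace_def)
qed

lemma mat_of_rows_list_2_carrier: "mat_of_rows_list 2 [[a, b], [c, d]] \<in> carrier_mat 2 2"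
  by (rule carrier_matI) (simp_all add: mat_of_rows_list_def)

lemma mat_trace_mat_of_rows_list_2: "mat_trace (mat_of_rows_list 2 [[a, b], [c, d]]) = a + d"
  by (simp add: mat_trace_def mat_of_rows_list_def numeral_2_eq_2)

lemma one_mat_2_eq: "1\<^sub>m 2 = mat_of_rows_list 2 [[1, 0], [0, 1]]"
  by (rule eq_matI) (auto simp: mat_of_rows_list_def numeral_2_eq_2 less_Suc_eq)

section \<open>The group \<open>Q\<^sup>-(2n, q)\<close>\<close>

lemma SO2_minus_carrier: "i \<in> SO2_minus \<kappa> \<Longrightarrow> i \<in> carrier_mat 2 2"
  by (auto simp: SO2_minus_def mat_of_rows_list_2_carrier)

lemma one_in_SO2_minus: "1\<^sub>m 2 \<in> SO2_minus \<kappa>"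
  unfolding SO2_minus_def one_mat_2_eq by (intro CollectI exI[of _ 1] exI[of _ 0]) simp

lemma mat_trace_SO2_minus:
  fixes \<kappa> :: "'a::field"
  assumes "CHAR('a) = 2"
  shows "mat_trace ` SO2_minus \<kappa> = {d2. \<exists>d1. d1\<^sup>2 + d1 * d2 + \<kappa> * d2\<^sup>2 = 1}"
proof -
  let ?M = "\<lambda>d1 d2. mat_of_rows_list 2 [[d1, \<kappa> * d2], [d2, d1 + d2]]"
  have trace: "mat_trace (?M d1 d2) = d2" for d1 d2
    by (simp add: mat_trace_mat_of_rows_list_2 add_self_CHAR_2[OF assms] flip: add.assoc)
  have "mat_trace ` SO2_minus \<kappa> =
      {mat_trace (?M d1 d2) | d1 d2. d1\<^sup>2 + d1 * d2 + \<kappa> * d2\<^sup>2 = 1}"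
    unfolding SO2_minus_def by blast
  then show ?thesis unfolding trace by blast
qed

lemma Q_unip_carrier:
  assumes "i \<in> carrier_mat 2 2" "B \<in> carrier_mat m m" "h \<in> carrier_mat 2 m"
  shows "Q_unip (Suc m) i B h \<in> carrier_mat (2 * Suc m) (2 * Suc m)"
  using assms by (auto simp: Q_unip_def append_rows_def)

lemma Q_unip_index:
  assumes "i \<in> carrier_mat 2 2" "B \<in> carrier_mat m m" "h \<in> carrier_mat 2 m"
  shows "a < m \<Longrightarrow> b < m \<Longrightarrow> Q_unip (Suc m) i B h $$ (a, b) = of_bool (a = b)"
    and "a < m \<Longrightarrow> b < m \<Longrightarrow> Q_unip (Suc m) i B h $$ (a, m + b) = B $$ (a, b)"
    and "a < m \<Longrightarrow> b < m \<Longrightarrow> Q_unip (Suc m) i B h $$ (m + a, b) = 0"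
    and "a < m \<Longrightarrow> b < m \<Longrightarrow> Q_unip (Suc m) i B h $$ (m + a, m + b) = of_bool (a = b)"
    and "a < 2 \<Longrightarrow> b < 2 \<Longrightarrow> Q_unip (Suc m) i B h $$ (m + m + a, m + m + b) = of_bool (a = b)"
  using assms by (simp_all add: Q_unip_def append_rows_def del: add_2_eq_Suc add_2_eq_Suc')

lemma Q_unip_zero:
  assumes "i \<in> carrier_mat 2 2"
  shows "Q_unip (Suc m) i (0\<^sub>m m m) (0\<^sub>m 2 m) = 1\<^sub>m (2 * Suc m)"
proof -
  have eta: "eta_mat \<in> carrier_mat 2 2"
    unfolding eta_mat_def by (rule mat_of_rows_list_2_carrier)
  have "transpose_mat (0\<^sub>m 2 m) * transpose_mat i * eta_mat * i = 0\<^sub>m m 2"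
    using assms by (simp add: left_mult_zero_mat[OF eta])
  moreover have "m + m + 2 = 2 * Suc m" by simp
  ultimately show ?thesis
    unfolding Q_unip_def diff_Suc_1 append_rows_def
    by (simp only: zero_transpose_mat index_zero_mat four_block_zero_mat four_block_one_mat
        add_0_right)
qed

lemma Q_levi_carrier:
  assumes "A \<in> carrier_mat m m" "A' \<in> carrier_mat m m" "i \<in> carrier_mat 2 2"
  shows "Q_levi A A' i \<in> carrier_mat (2 * Suc m) (2 * Suc m)"
  using assms by (intro carrier_matI) (simp_all add: Q_levi_def dim_diag_block_mat)

lemma Q_levi_one: "Q_levi (1\<^sub>m m) (1\<^sub>m m) (1\<^sub>m 2) = (1\<^sub>m (2 * Suc m) :: 'a::field mat)"
proof -
  let ?Is = "[1\<^sub>m m, 1\<^sub>m m, 1\<^sub>m 2] :: 'a mat list"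
  have "Q_levi (1\<^sub>m m) (1\<^sub>m m) (1\<^sub>m 2 :: 'a mat) = diag_block_mat (map (\<lambda>A. 1\<^sub>m (dim_row A)) ?Is)"
    by (simp only: Q_levi_def list.map transpose_one index_one_mat)
  also have "\<dots> = 1\<^sub>m (sum_list (map dim_row ?Is))"
    by (rule diag_block_one_mat)
  finally show ?thesis by (simp add: mult_2)
qed

lemma mat_trace_Q_levi:
  assumes "A \<in> carrier_mat m m" "A' \<in> carrier_mat m m" "i \<in> carrier_mat 2 2"
  shows "mat_trace (Q_levi A A' i) = mat_trace A + mat_trace A' + mat_trace i"
  unfolding Q_levi_def using assms
  by (subst mat_trace_diag_block_mat) (auto simp: mat_trace_transpose_mat add.assoc)

lemma alternating_mat_zero: "alternating_mat (0\<^sub>m m m)"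
  by (auto simp: alternating_mat_def)

lemma Q_levi_mult_Q_unip_in_Q_minus:
  assumes A: "A \<in> carrier_mat m m" "A' \<in> carrier_mat m m" "A * A' = 1\<^sub>m m"
    and i: "i \<in> SO2_minus \<kappa>"
    and Bh: "B \<in> carrier_mat m m" "h \<in> carrier_mat 2 m"
      "alternating_mat (transpose_mat B + transpose_mat h * delta_mat \<kappa> * h)"
  shows "Q_levi A A' i * Q_unip (Suc m) i B h \<in> Q_minus \<kappa> (Suc m)"
proof -
  have "inverts_mat A A'" "inverts_mat A' A"
    using A mat_mult_left_right_inverse[OF A] by (simp_all add: inverts_mat_def)
  then show ?thesis
    unfolding Q_minus_def diff_Suc_1 using A i Bh by blast
qed

lemma Q_levi_in_Q_minus:
  assumes A: "A \<in> carrier_mat m m" "A' \<in> carrier_mat m m" "A * A' = 1\<^sub>m m"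
    and i: "i \<in> SO2_minus \<kappa>"
  shows "Q_levi A A' i \<in> Q_minus \<kappa> (Suc m)"
proof -
  have "delta_mat \<kappa> \<in> carrier_mat 2 2"
    unfolding delta_mat_def by (rule mat_of_rows_list_2_carrier)
  then have "transpose_mat (0\<^sub>m m m) + transpose_mat (0\<^sub>m 2 m) * delta_mat \<kappa> * 0\<^sub>m 2 m = 0\<^sub>m m m"
    by simp
  then have "Q_levi A A' i * Q_unip (Suc m) i (0\<^sub>m m m) (0\<^sub>m 2 m) \<in> Q_minus \<kappa> (Suc m)"
    using A i
    by (intro Q_levi_mult_Q_unip_in_Q_minus) (simp_all only: zero_carrier_mat alternating_mat_zero)
  then show ?thesis
    using Q_levi_carrier[OF A(1,2) SO2_minus_carrier[OF i]]
    by (simp only: Q_unip_zero[OF SO2_minus_carrier[OF i]] right_mult_one_mat)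
qed

lemma Q_unip_in_Q_minus:
  assumes "B \<in> carrier_mat m m" "h \<in> carrier_mat 2 m"
    and "alternating_mat (transpose_mat B + transpose_mat h * delta_mat \<kappa> * h)"
  shows "Q_unip (Suc m) (1\<^sub>m 2) B h \<in> Q_minus \<kappa> (Suc m)"
proof -
  have "Q_levi (1\<^sub>m m) (1\<^sub>m m) (1\<^sub>m 2) * Q_unip (Suc m) (1\<^sub>m 2) B h \<in> Q_minus \<kappa> (Suc m)"
    using assms one_in_SO2_minus by (intro Q_levi_mult_Q_unip_in_Q_minus) auto
  then show ?thesis
    using Q_unip_carrier[OF one_carrier_mat assms(1,2)]
    by (simp only: Q_levi_one left_mult_one_mat)
qed

lemma one_in_Q_minus: "1\<^sub>m (2 * Suc m) \<in> Q_minus \<kappa> (Suc m)"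
  unfolding Q_levi_one[symmetric]
  by (rule Q_levi_in_Q_minus) (auto simp: one_in_SO2_minus)

section \<open>Multiplication by \<open>\<sigma>\<^sub>s\<close> and \<open>\<rho>\<close>\<close>

lemma sigma_mat_carrier: "sigma_mat n s \<in> carrier_mat (2 * n) (2 * n)"
  by (simp add: sigma_mat_def)

lemma mult_sigma_in_Q_double_coset:
  assumes "x \<in> Q_minus \<kappa> (Suc m)"
  shows "x * sigma_mat (Suc m) s \<in> Q_double_coset \<kappa> (Suc m) s"
proof -
  have "x * sigma_mat (Suc m) s * 1\<^sub>m (2 * Suc m) = x * sigma_mat (Suc m) s"
    by (rule right_mult_one_mat') (simp add: sigma_mat_def)
  then show ?thesis
    unfolding Q_double_coset_def using assms one_in_Q_minus[of m \<kappa>]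
    by (metis (mono_tags, lifting) CollectI)
qed

lemma sigma_perm_less: "s \<le> m \<Longrightarrow> j < 2 * Suc m \<Longrightarrow> sigma_perm (Suc m) s j < 2 * Suc m"
  by (auto simp: sigma_perm_def)

lemma index_mult_sigma_mat:
  fixes x :: "'a::field mat"
  assumes x: "x \<in> carrier_mat (2 * Suc m) (2 * Suc m)"
    and "s \<le> m" "a < 2 * Suc m" "b < 2 * Suc m"
  shows "(x * sigma_mat (Suc m) s) $$ (a, b) = x $$ (a, sigma_perm (Suc m) s b)"
proof -
  let ?b = "sigma_perm (Suc m) s b"
  have "?b < 2 * Suc m" using assms by (intro sigma_perm_less)
  have "col (sigma_mat (Suc m) s) b = (unit_vec (2 * Suc m) ?b :: 'a vec)"
    using assms by (intro eq_vecI) (auto simp: sigma_mat_def unit_vec_def simp del: mult_Suc_right)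
  then have "(x * sigma_mat (Suc m) s) $$ (a, b) = row x a \<bullet> unit_vec (2 * Suc m) ?b"
    using assms sigma_mat_carrier[of "Suc m" s, where 'a = 'a]
    by (simp del: mult_Suc_right)
  also have "\<dots> = x $$ (a, ?b)"
    using assms \<open>?b < 2 * Suc m\<close> by (simp del: mult_Suc_right)
  finally show ?thesis .
qed

lemma mult_sigma_mat_0:
  assumes "x \<in> carrier_mat (2 * Suc m) (2 * Suc m)"
  shows "x * sigma_mat (Suc m) 0 = x"
  using assms mult_carrier_mat[OF assms sigma_mat_carrier, of 0]
  by (intro eq_matI) (auto simp: index_mult_sigma_mat sigma_perm_def simp del: mult_Suc_right)

lemma rho_mat_eq_addrow_mat: "rho_mat (Suc m) = addrow_mat (2 * Suc m) 1 (2 * m) (2 * m + 1)"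
  by (rule eq_matI) (auto simp: rho_mat_def Let_def mat_of_rows_list_def nth_Cons')

lemma mat_trace_rho_mult:
  fixes y :: "'a::field mat"
  assumes "y \<in> carrier_mat (2 * Suc m) (2 * Suc m)"
  shows "mat_trace (rho_mat (Suc m) * y) = mat_trace y + y $$ (2 * m + 1, 2 * m)"
proof -
  have "rho_mat (Suc m) * y = addrow 1 (2 * m) (2 * m + 1) y"
    unfolding rho_mat_eq_addrow_mat by (subst addrow_mat[OF assms]) simp_all
  then show ?thesis using mat_trace_addrow[OF assms, of "2 * m" 1 "2 * m + 1"] by simp
qed

section \<open>Traces on the double cosets\<close>

lemma mat_trace_Q_unip_mult_sigma_mat:
  assumes carrier: "i \<in> carrier_mat 2 2" "B \<in> carrier_mat m m" "h \<in> carrier_mat 2 m"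
    and s: "s \<le> m"
  shows "mat_trace (Q_unip (Suc m) i B h * sigma_mat (Suc m) s) =
    (\<Sum>a<s. B $$ (a, a)) + of_nat (2 * (m - s) + 2)"
proof -
  define x where "x = Q_unip (Suc m) i B h"
  note x_index = Q_unip_index[OF carrier, folded x_def]
  let ?f = "\<lambda>a. x $$ (a, sigma_perm (Suc m) s a)"
  have moved: "?f a = B $$ (a, a)" "?f (m + a) = 0" if "a < s" for a
    using that s x_index(2,3) by (simp_all add: sigma_perm_def)
  have fixed: "?f (s + a) = 1" "?f (m + (s + a)) = 1" if "a < m - s" for a
  proof -
    have "s + a < m" using that by simp
    then show "?f (s + a) = 1" "?f (m + (s + a)) = 1"
      using x_index(1,4) by (simp_all add: sigma_perm_def)
  qed
  have last: "?f (m + m + a) = 1" if "a < 2" for a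
    using that s x_index(5) by (simp add: sigma_perm_def)
  have "mat_trace (x * sigma_mat (Suc m) s) = (\<Sum>a<m + m + 2. ?f a)"
    unfolding mat_trace_def using s Q_unip_carrier[OF carrier]
    by (intro sum.cong) (auto simp: x_def index_mult_sigma_mat simp del: index_mult_mat(1))
  also have "\<dots> = (\<Sum>a<s + (m - s). ?f a) + (\<Sum>a<s + (m - s). ?f (m + a)) +
      (\<Sum>a<2. ?f (m + m + a))"
    using s by (simp only: sum_lessThan_add le_add_diff_inverse)
  also have "\<dots> = (\<Sum>a<s. B $$ (a, a)) + of_nat (m - s) + of_nat (m - s) + of_nat 2"
    by (simp only: sum_lessThan_add) (simp add: moved fixed last)
  finally show ?thesis by (simp add: x_def)
qed

lemma mat_trace_rho_mult_Q_unip_mult_sigma_mat: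
  assumes carrier: "i \<in> carrier_mat 2 2" "B \<in> carrier_mat m m" "h \<in> carrier_mat 2 m"
    and s: "s \<le> m"
  shows "mat_trace (rho_mat (Suc m) * (Q_unip (Suc m) i B h * sigma_mat (Suc m) s)) =
    mat_trace (Q_unip (Suc m) i B h * sigma_mat (Suc m) s)"
proof -
  have "(Q_unip (Suc m) i B h * sigma_mat (Suc m) s) $$ (2 * m + 1, 2 * m) =
      Q_unip (Suc m) i B h $$ (m + m + 1, m + m + 0)"
    using s Q_unip_carrier[OF carrier]
    by (subst index_mult_sigma_mat) (auto simp: sigma_perm_def mult_2)
  also have "\<dots> = 0" by (subst Q_unip_index(5)[OF carrier]) auto
  finally show ?thesis
    using mat_trace_rho_mult[OF mult_carrier_mat[OF Q_unip_carrier[OF carrier] sigma_mat_carrier]]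
    by simp
qed

definition corner_mat :: "nat \<Rightarrow> nat \<Rightarrow> 'a::zero \<Rightarrow> 'a mat" where
  "corner_mat k m t = mat k m (\<lambda>(a, b). if a = 0 \<and> b = 0 then t else 0)"

lemma corner_mat_carrier: "corner_mat k m t \<in> carrier_mat k m"
  by (simp add: corner_mat_def)

lemma alternating_mat_corner_mat:
  fixes t \<kappa> :: "'a::field"
  assumes "CHAR('a) = 2"
  shows "alternating_mat (transpose_mat (corner_mat m m (t\<^sup>2)) +
    transpose_mat (corner_mat 2 m t) * delta_mat \<kappa> * corner_mat 2 m t)"
proof -
  have "transpose_mat (corner_mat m m (t\<^sup>2)) +
      transpose_mat (corner_mat 2 m t) * delta_mat \<kappa> * corner_mat 2 m t = 0\<^sub>m m m"
    using add_self_CHAR_2[OF assms, of "t * t"]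
    by (intro eq_matI) (auto simp: corner_mat_def delta_mat_def mat_of_rows_list_def
        scalar_prod_def numeral_2_eq_2 power2_eq_square)
  then show ?thesis by (simp only: alternating_mat_zero)
qed

lemma ex_Q_double_coset_mat_trace_eq:
  fixes \<kappa> y :: "'a::{field,finite}"
  assumes char: "CHAR('a) = 2" and s: "0 < s" "s \<le> m"
  shows "\<exists>x\<in>Q_double_coset \<kappa> (Suc m) s. mat_trace x = y \<and> mat_trace (rho_mat (Suc m) * x) = y"
proof -
  obtain t where "y = t\<^sup>2" using surj_power2_CHAR_2[OF char] by (metis surjD)
  let ?x = "Q_unip (Suc m) (1\<^sub>m 2) (corner_mat m m (t\<^sup>2)) (corner_mat 2 m t)"
  note carrier = one_carrier_mat corner_mat_carrier[of m m "t\<^sup>2"] corner_mat_carrier[of 2 m t]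
  have "(\<Sum>a<s. corner_mat m m (t\<^sup>2) $$ (a, a)) = (\<Sum>a<s. if a = 0 then t\<^sup>2 else 0)"
    using s by (intro sum.cong) (auto simp: corner_mat_def)
  moreover have "of_nat (2 * (m - s) + 2) = (0 :: 'a)"
    by (simp only: of_nat_eq_0_iff_char_dvd char) simp
  ultimately have "mat_trace (?x * sigma_mat (Suc m) s) = y"
    using s \<open>y = t\<^sup>2\<close> by (simp only: mat_trace_Q_unip_mult_sigma_mat[OF carrier]) simp
  moreover from this have "mat_trace (rho_mat (Suc m) * (?x * sigma_mat (Suc m) s)) = y"
    by (simp only: mat_trace_rho_mult_Q_unip_mult_sigma_mat[OF carrier s(2)])
  moreover have "?x * sigma_mat (Suc m) s \<in> Q_double_coset \<kappa> (Suc m) s"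
    using corner_mat_carrier alternating_mat_corner_mat[OF char]
    by (intro mult_sigma_in_Q_double_coset Q_unip_in_Q_minus)
  ultimately show ?thesis by blast
qed

lemma Q_levi_in_Q_double_coset_0:
  assumes A: "A \<in> carrier_mat m m" "A' \<in> carrier_mat m m" "A * A' = 1\<^sub>m m"
    and i: "i \<in> SO2_minus \<kappa>"
  shows "Q_levi A A' i \<in> Q_double_coset \<kappa> (Suc m) 0"
  using mult_sigma_in_Q_double_coset[OF Q_levi_in_Q_minus[OF A i], of 0]
  by (simp only: mult_sigma_mat_0[OF Q_levi_carrier[OF A(1,2) SO2_minus_carrier[OF i]]])

lemma mat_trace_SO2_minus_subset:
  fixes \<kappa> :: "'a::field"
  assumes "CHAR('a) = 2"
  shows "mat_trace ` SO2_minus \<kappa> \<subseteq> mat_trace ` Q_double_coset \<kappa> (Suc m) 0"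
proof (rule image_subsetI)
  fix i assume i: "i \<in> SO2_minus \<kappa>"
  have "mat_trace (Q_levi (1\<^sub>m m) (1\<^sub>m m) i) = mat_trace i"
    using SO2_minus_carrier[OF i]
    by (simp add: mat_trace_Q_levi[where m = m] mat_trace_one_mat add_self_CHAR_2[OF assms])
  moreover have "Q_levi (1\<^sub>m m) (1\<^sub>m m) i \<in> Q_double_coset \<kappa> (Suc m) 0"
    using i by (intro Q_levi_in_Q_double_coset_0) auto
  ultimately show "mat_trace i \<in> mat_trace ` Q_double_coset \<kappa> (Suc m) 0"
    by (metis image_eqI)
qed

definition GL_trace_sums :: "nat \<Rightarrow> 'a::field set" where
  "GL_trace_sums m = {mat_trace A + mat_trace A' | A A'.
     A \<in> carrier_mat m m \<and> A' \<in> carrier_mat m m \<and> A * A' = 1\<^sub>m m}"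

lemma GL_trace_sums_subset:
  fixes \<kappa> :: "'a::field"
  assumes char: "CHAR('a) = 2"
  shows "GL_trace_sums m \<subseteq> mat_trace ` (*) (rho_mat (Suc m)) ` Q_double_coset \<kappa> (Suc m) 0"
proof
  fix y :: 'a assume "y \<in> GL_trace_sums m"
  then obtain A A' where y: "y = mat_trace A + mat_trace A'"
    and A: "A \<in> carrier_mat m m" "A' \<in> carrier_mat m m" "A * A' = 1\<^sub>m m"
    by (auto simp: GL_trace_sums_def)
  let ?x = "Q_levi A A' (1\<^sub>m 2)"
  have "?x $$ (2 * m + 1, 2 * m) = 0"
    using A by (auto simp: Q_levi_def Let_def)
  then have "mat_trace (rho_mat (Suc m) * ?x) = y + of_nat 2"
    using A Q_levi_carrier[OF A(1,2) one_carrier_mat]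
    by (simp add: y mat_trace_rho_mult mat_trace_Q_levi[OF A(1,2)] mat_trace_one_mat)
  then have "mat_trace (rho_mat (Suc m) * ?x) = y"
    using of_nat_CHAR[where 'a = 'a] by (simp only: char add_0_right)
  moreover have "?x \<in> Q_double_coset \<kappa> (Suc m) 0"
    using A one_in_SO2_minus by (rule Q_levi_in_Q_double_coset_0)
  ultimately show "y \<in> mat_trace ` (*) (rho_mat (Suc m)) ` Q_double_coset \<kappa> (Suc m) 0"
    by (metis image_eqI)
qed

lemma inverse_sums_subset_GL_trace_sums_1: "inverse_sums \<subseteq> GL_trace_sums 1"
proof
  fix y :: 'a assume "y \<in> inverse_sums"
  then obtain a where "a \<noteq> 0" and y: "y = a + inverse a" by (auto simp: inverse_sums_def)
  have "mat 1 1 (\<lambda>_. a) * mat 1 1 (\<lambda>_. inverse a) = 1\<^sub>m 1"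
    using \<open>a \<noteq> 0\<close> by (auto simp: scalar_prod_def)
  then show "y \<in> GL_trace_sums 1"
    unfolding GL_trace_sums_def y
    by (intro CollectI exI[of _ "mat 1 1 (\<lambda>_. a)"] exI[of _ "mat 1 1 (\<lambda>_. inverse a)"])
      (simp add: mat_trace_def)
qed

lemma GL_trace_sums_2_eq_UNIV:
  assumes "CARD('a::{field,finite}) > 2"
  shows "GL_trace_sums 2 = (UNIV :: 'a set)"
proof -
  obtain d :: 'a where d: "d \<noteq> 0" "d \<noteq> - 1"
  proof -
    have "\<not> UNIV \<subseteq> {0, - 1 :: 'a}"
      using card_mono[of "{0, - 1 :: 'a}" UNIV] assms by (auto simp: card_insert_if split: if_splits)
    then show ?thesis using that by blast
  qed
  have "y \<in> GL_trace_sums 2" for y :: 'a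
  proof -
    define t where "t = y / (1 + inverse d)"
    let ?A = "mat_of_rows_list 2 [[t, - d], [1, 0]]"
    let ?A' = "mat_of_rows_list 2 [[0, 1], [- inverse d, t * inverse d]]"
    have "?A * ?A' = 1\<^sub>m 2"
      using d by (auto intro!: eq_matI simp: mat_of_rows_list_def scalar_prod_def numeral_2_eq_2
          less_Suc_eq)
    moreover have "mat_trace ?A + mat_trace ?A' = t * (1 + inverse d)"
      by (simp add: mat_trace_mat_of_rows_list_2 distrib_left)
    moreover have "1 + inverse d \<noteq> 0" using d by (auto simp: field_simps add_eq_0_iff)
    then have "t * (1 + inverse d) = y" by (simp add: t_def)
    ultimately show ?thesis
      unfolding GL_trace_sums_def using mat_of_rows_list_2_carrier
      by (metis (mono_tags, lifting) CollectI)
  qed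
  then show ?thesis by blast
qed

section \<open>Generation by the traces of a double coset\<close>

lemma irreducible_quadratic_no_root:
  fixes \<kappa> z :: "'a::field"
  assumes "irreducible [:\<kappa>, 1, 1:]"
  shows "z\<^sup>2 + z + \<kappa> \<noteq> 0"
  using assms root_imp_reducible_poly[of "[:\<kappa>, 1, 1:]" z]
  by (auto simp: power2_eq_square algebra_simps)

lemma group_closure_mat_trace_Q_double_coset:
  fixes \<kappa> :: "'a::{field,finite}"
  assumes char: "CHAR('a) = 2" and irreducible: "irreducible [:\<kappa>, 1, 1:]" and "s \<le> m"
  shows "group_closure (mat_trace ` Q_double_coset \<kappa> (Suc m) s) = UNIV"
proof (cases "s = 0")
  case True
  have "group_closure (mat_trace ` SO2_minus \<kappa>) = UNIV"
    unfolding mat_trace_SO2_minus[OF char]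
    by (intro group_closure_eq_UNIV_if_card_gt_half card_norm_one_second_coordinates char
        irreducible_quadratic_no_root irreducible)
  then show ?thesis
    using True group_closure_mono[OF mat_trace_SO2_minus_subset[OF char, of \<kappa> m]] by auto
next
  case False
  then have "mat_trace ` Q_double_coset \<kappa> (Suc m) s = UNIV"
    using ex_Q_double_coset_mat_trace_eq[OF char _ \<open>s \<le> m\<close>, of \<kappa>]
    by (metis UNIV_eq_I image_eqI neq0_conv)
  then show ?thesis using group_closure_superset by blast
qed

lemma group_closure_mat_trace_rho_Q_double_coset:
  fixes \<kappa> :: "'a::{field,finite}"
  assumes char: "CHAR('a) = 2" and "s \<le> m"
    and positive_or_large: "0 < s \<or> m = 1 \<and> CARD('a) \<ge> 8 \<or> m = 2 \<and> CARD('a) \<ge> 4"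
  shows "group_closure (mat_trace ` (*) (rho_mat (Suc m)) ` Q_double_coset \<kappa> (Suc m) s) = UNIV"
proof (cases "s = 0")
  case True
  then consider (scalar) "m = 1" "CARD('a) \<ge> 8" | (companion) "m = 2" "CARD('a) > 2"
    using positive_or_large by linarith
  then have "group_closure (GL_trace_sums m) = (UNIV :: 'a set)"
  proof cases
    case scalar
    then show ?thesis
      using group_closure_mono[OF inverse_sums_subset_GL_trace_sums_1]
        group_closure_inverse_sums_eq_UNIV by blast
  next
    case companion
    then show ?thesis
      using group_closure_superset GL_trace_sums_2_eq_UNIV by blast
  qed
  then show ?thesis
    using True group_closure_mono[OF GL_trace_sums_subset[OF char, of m \<kappa>]] by auto
next
  case False
  then have "mat_trace ` (*) (rho_mat (Suc m)) ` Q_double_coset \<kappa> (Suc m) s = UNIV"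
    using ex_Q_double_coset_mat_trace_eq[OF char _ \<open>s \<le> m\<close>, of \<kappa>]
    by (metis UNIV_eq_I image_eqI neq0_conv)
  then show ?thesis using group_closure_superset by blast
qed

theorem theorem15:
  fixes \<kappa> :: "'a::{field,finite}" and r n i :: nat and gs :: "'a mat list"
  assumes "CARD('a) = 2 ^ r"
    and "irreducible [:\<kappa>, 1, 1:]"
    and "distinct gs" and "set gs = DC \<kappa> i n"
    and "(i \<in> {1, 2} \<and> even n \<and> n \<ge> 2) \<or>
      (i = 3 \<and> even n \<and> (n \<ge> 4 \<or> (n = 2 \<and> CARD('a) \<ge> 8))) \<or>
      (i = 4 \<and> even n \<and> n \<ge> 4) \<or>
      (i = 1 \<and> odd n \<and> n \<ge> 1) \<or>
      (i \<in> {2, 3} \<and> odd n \<and> n \<ge> 3) \<or>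
      (i = 4 \<and> odd n \<and> (n \<ge> 5 \<or> (n = 3 \<and> CARD('a) \<ge> 4)))"
  shows "F2_linear_iso (trace_word r gs) (dual_code (length gs) (trace_code gs))"
proof (rule F2_linear_iso_trace_word[OF assms(1)])
  have char: "CHAR('a) = 2" using assms(1) by (rule CHAR_eq_2)
  obtain m where n: "n = Suc m" using assms(5) by (cases n) auto
  consider (plain) s where "s \<le> m" "DC \<kappa> i n = Q_double_coset \<kappa> (Suc m) s"
    | (rho) s where "s \<le> m" "0 < s \<or> m = 1 \<and> CARD('a) \<ge> 8 \<or> m = 2 \<and> CARD('a) \<ge> 4"
      "DC \<kappa> i n = (*) (rho_mat (Suc m)) ` Q_double_coset \<kappa> (Suc m) s"
  proof -
    have "i = 1 \<or> i = 2 \<or> i = 3 \<and> (m > 1 \<or> m = 1 \<and> CARD('a) \<ge> 8)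
        \<or> i = 4 \<and> (m > 2 \<or> m = 2 \<and> CARD('a) \<ge> 4)"
      using assms(5) unfolding n by (auto; presburger)
    then show ?thesis
      using plain[of m] plain[of "m - 1"] rho[of "m - 1"] rho[of "m - 2"] by (auto simp: DC_def n)
  qed
  then show "group_closure (mat_trace ` set gs) = UNIV"
  proof cases
    case plain
    then show ?thesis
      using group_closure_mat_trace_Q_double_coset[OF char assms(2)] by (simp add: assms(4))
  next
    case rho
    then show ?thesis
      using group_closure_mat_trace_rho_Q_double_coset[OF char] by (simp add: assms(4))
  qed
qed

end
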